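(* For every integer $n\ge 3$, the minimum defect in a $2$-coloring of the fan $F_n$ is \[ D(F_n,2)=\frac{2\lfloor n/3\rfloor}{\lfloor n/3\rfloor+1}. \]
   Context: Graphs are finite and simple. For a graph $G$ and a positive integer $k$, a (fractional) $k$-coloring of $G$ is an assignment to every vertex $v$ of real numbers $f_1(v),\dots,f_k(v)\ge 0$ with $\sum_{j=1}^k f_j(v)=1$ ($f_j(v)$ is the usage of color $j$ at $v$). The defect of $v$ is $\mathrm{df}(v)=\sum_{w\in N(v)}\sum_{j=1}^k\min(f_j(v),f_j(w))$, where $N(v)$ is the set of neighbors of $v$. The defect of the coloring is $\max_v \mathrm{df}(v)$, and the minimum defect $D(G,k)$ is the minimum of this quantity over all $k$-colorings of $G$. The fan $F_n$ is the graph obtained from a path on $n$ vertices by adding a new vertex and joining it to every vertex of the path. *)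

theory Defs
  imports "HOL-Analysis.Analysis" "Graph_Theory.Pair_Digraph"
begin

(* A finite simple graph is a pair_graph: finite vertex set, symmetric irreflexive arc relation.
   The number f v j is the usage of color j at v; the colors are 1, ..., k, and only the values
   of f at vertices and colors matter. *)

definition k_coloring :: "'a pair_pre_digraph \<Rightarrow> nat \<Rightarrow> ('a \<Rightarrow> nat \<Rightarrow> real) \<Rightarrow> bool" where
  "k_coloring G k f \<longleftrightarrow>
     (\<forall>v\<in>pverts G. (\<forall>j\<in>{1..k}. f v j \<ge> 0) \<and> (\<Sum>j=1..k. f v j) = 1)"

definition nbhd :: "'a pair_pre_digraph \<Rightarrow> 'a \<Rightarrow> 'a set" where
  "nbhd G v = {w. (v, w) \<in> parcs G}"

definition vertex_defect ::
    "'a pair_pre_digraph \<Rightarrow> nat \<Rightarrow> ('a \<Rightarrow> nat \<Rightarrow> real) \<Rightarrow> 'a \<Rightarrow> real" where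
  "vertex_defect G k f v = (\<Sum>w\<in>nbhd G v. \<Sum>j=1..k. min (f v j) (f w j))"

definition defect :: "'a pair_pre_digraph \<Rightarrow> nat \<Rightarrow> ('a \<Rightarrow> nat \<Rightarrow> real) \<Rightarrow> real" where
  "defect G k f = Max (vertex_defect G k f ` pverts G)"

(* LEAST on real is meaningful only if the minimum is attained; see min_defect_attained below. *)
definition min_defect :: "'a pair_pre_digraph \<Rightarrow> nat \<Rightarrow> real" where
  "min_defect G k = (LEAST d. \<exists>f. k_coloring G k f \<and> d = defect G k f)"

definition path_graph :: "nat \<Rightarrow> nat pair_pre_digraph" where
  "path_graph n = \<lparr> pverts = {1..n},
     parcs = {(i, j). i \<in> {1..n} \<and> j \<in> {1..n} \<and> (j = Suc i \<or> i = Suc j)} \<rparr>"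

(* The vertex 0 does not belong to path_graph n and plays the role of the added vertex. *)
definition fan :: "nat \<Rightarrow> nat pair_pre_digraph" where
  "fan n = \<lparr> pverts = insert 0 (pverts (path_graph n)),
     parcs = parcs (path_graph n) \<union> {0} \<times> pverts (path_graph n) \<union> pverts (path_graph n) \<times> {0} \<rparr>"

lemma pair_graph_path_graph: "pair_graph (path_graph n)"
proof -
  have "finite (parcs (path_graph n))"
    by (rule finite_subset[of _ "{1..n} \<times> {1..n}"]) (auto simp: path_graph_def)
  then show ?thesis
    by unfold_locales (auto simp: path_graph_def symmetric_def intro!: symI)
qed

lemma pair_graph_fan: "pair_graph (fan n)"
proof -
  interpret P: pair_graph "path_graph n" by (rule pair_graph_path_graph)
  have "finite (parcs (fan n))"
    by (simp add: fan_def P.pair_finite_arcs P.pair_finite_verts)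
  then show ?thesis
    by unfold_locales (auto simp: fan_def path_graph_def symmetric_def intro!: symI)
qed

lemma continuous_on_Max_image:
  fixes h :: "'i \<Rightarrow> 'b::topological_space \<Rightarrow> real"
  assumes "finite I" "I \<noteq> {}" "\<And>i. i \<in> I \<Longrightarrow> continuous_on S (h i)"
  shows "continuous_on S (\<lambda>x. Max ((\<lambda>i. h i x) ` I))"
  using assms
proof (induction I rule: finite_ne_induct)
  case (singleton i)
  then show ?case by simp
next
  case (insert i I)
  have "continuous_on S (\<lambda>x. max (h i x) (Max ((\<lambda>i. h i x) ` I)))"
    using insert by (intro continuous_on_max) auto
  then show ?case using insert by simp
qed

lemma min_defect_attained:
  fixes G :: "'a pair_pre_digraph"
  assumes G: "pair_graph G" "pverts G \<noteq> {}" and k: "k \<ge> 1"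
  shows "\<exists>f. k_coloring G k f \<and> defect G k f = min_defect G k"
    and "\<And>g. k_coloring G k g \<Longrightarrow> min_defect G k \<le> defect G k g"
proof -
  interpret pair_graph G by (rule G(1))
  define c where "c = (\<lambda>(g :: 'a \<times> nat \<Rightarrow> real) v j. g (v, j))"
  define P where "P = PiE UNIV (\<lambda>_ :: 'a \<times> nat. {0..1::real})"
  define K where "K = P \<inter> (\<Inter>v. {g. (\<Sum>j=1..k. g (v, j)) = 1})"
  have "compactin (product_topology (\<lambda>_ :: 'a \<times> nat. euclidean :: real topology) UNIV) P"
    unfolding P_def by (subst compactin_PiE) auto
  then have "compact P"
    by (simp add: euclidean_product_topology)
  moreover have "closed (\<Inter>v. {g :: 'a \<times> nat \<Rightarrow> real. (\<Sum>j=1..k. g (v, j)) = 1})"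
    by (intro closed_INT ballI closed_Collect_eq continuous_on_sum continuous_on_const)
       (auto intro: continuous_on_product_coordinates)
  ultimately have compK: "compact K"
    unfolding K_def by (rule compact_Int_closed)
  have repr: "\<exists>g\<in>K. defect G k (c g) = defect G k f" if f: "k_coloring G k f" for f
  proof -
    define g where "g = (\<lambda>(v, j). if v \<in> pverts G
      then (if j \<in> {1..k} then f v j else 0) else (if j = 1 then 1 else 0 :: real))"
    have le1: "f v j \<le> 1" if "v \<in> pverts G" "j \<in> {1..k}" for v j
    proof -
      have "f v j \<le> (\<Sum>j=1..k. f v j)"
        using f that by (intro member_le_sum) (auto simp: k_coloring_def)
      then show ?thesis using f that by (simp add: k_coloring_def)
    qed
    have "(\<Sum>j=1..k. g (v, j)) = 1" for v
    proof (cases "v \<in> pverts G")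
      case True
      then have "(\<Sum>j=1..k. g (v, j)) = (\<Sum>j=1..k. f v j)"
        by (intro sum.cong) (auto simp: g_def)
      then show ?thesis using f True by (simp add: k_coloring_def)
    next
      case False
      then show ?thesis using k by (simp add: g_def)
    qed
    moreover have "g \<in> P"
      using f le1 by (auto simp: P_def g_def k_coloring_def)
    ultimately have "g \<in> K" by (auto simp: K_def)
    moreover have "vertex_defect G k (c g) v = vertex_defect G k f v" if "v \<in> pverts G" for v
      unfolding vertex_defect_def
      using that by (intro sum.cong) (auto simp: c_def g_def nbhd_def dest: in_arcsD2)
    then have "defect G k (c g) = defect G k f"
      unfolding defect_def by (metis (no_types, lifting) image_cong)
    ultimately show ?thesis by blast
  qed
  have col: "k_coloring G k (c g)" if "g \<in> K" for g
    using that by (auto simp: K_def P_def k_coloring_def c_def PiE_iff)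
  have "k_coloring G k (\<lambda>v j. if j = 1 then 1 else 0)"
    using k by (auto simp: k_coloring_def)
  then have ne: "K \<noteq> {}" using repr by blast
  have "continuous_on K (\<lambda>g. defect G k (c g))"
    unfolding defect_def vertex_defect_def c_def
    using G(2) pair_finite_verts
    by (intro continuous_on_Max_image continuous_on_sum continuous_on_min)
       (auto intro: continuous_on_subset[OF continuous_on_product_coordinates])
  then obtain g where g: "g \<in> K" "\<And>h. h \<in> K \<Longrightarrow> defect G k (c g) \<le> defect G k (c h)"
    using continuous_attains_inf[OF compK ne] by blast
  have min: "defect G k (c g) \<le> defect G k f" if "k_coloring G k f" for f
    using repr[OF that] g(2) by metis
  have eq: "min_defect G k = defect G k (c g)"
    unfolding min_defect_def using col[OF g(1)] min by (intro Least_equality) auto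
  show "\<exists>f. k_coloring G k f \<and> defect G k f = min_defect G k"
    using col[OF g(1)] eq by metis
  show "\<And>g. k_coloring G k g \<Longrightarrow> min_defect G k \<le> defect G k g"
    using min eq by simp
qed

end

theory Submission
  imports Defs
begin

text \<open>
  With two colors a vertex is described by its usage of color 1 alone, and an edge between vertices
  with usages \<open>x\<close> and \<open>y\<close> contributes \<open>1 - \<bar>x - y\<bar>\<close> to the defect of both of its ends. Three
  numbers in \<open>[0, 1]\<close> have pairwise distances adding up to at most \<open>2\<close>, so the three edges of any
  triangle contribute at least \<open>1\<close> in total (\<open>shared_triangle\<close>). Put \<open>m = n div 3\<close>.

  Lower bound: cut the first \<open>3 m\<close> path vertices into \<open>m\<close> consecutive triples. The hub and a triple
  \<open>u, v, w\<close> span the two triangles \<open>hub, u, v\<close> and \<open>hub, v, w\<close>. The defect of the middle vertex \<open>v\<close>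
  counts the edges to \<open>hub\<close>, \<open>u\<close> and \<open>w\<close>, and the defect of the hub counts those to \<open>u\<close>, \<open>v\<close> and
  \<open>w\<close>; together these are exactly the edges of the two triangles, the common edge being counted
  twice. Hence the defects of the hub and of the \<open>m\<close> middle vertices add up to at least \<open>2 m\<close>, and
  one of these \<open>m + 1\<close> defects is at least \<open>2 m / (m + 1)\<close>.

  Upper bound: the hub uses only color 2, and the path vertices use only color 1, except that every
  third one uses it to the extent \<open>c\<close>. Every inner path vertex is exceptional or next to exactly one
  exceptional vertex, and in both cases its defect is \<open>1 + c\<close>;
  the two ends of the path have defect at most \<open>1\<close>. The hub has defect \<open>m (1 - c)\<close>.
  The value \<open>c = (m - 1) / (m + 1)\<close> makes the two equal to \<open>2 m / (m + 1)\<close>.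
\<close>

definition shared :: "('a \<Rightarrow> nat \<Rightarrow> real) \<Rightarrow> 'a \<Rightarrow> 'a \<Rightarrow> real" where
  "shared f v w = (\<Sum>j=1..2. min (f v j) (f w j))"

lemma vertex_defect_shared: "vertex_defect G 2 f v = (\<Sum>w\<in>nbhd G v. shared f v w)"
  by (simp add: vertex_defect_def shared_def)

lemma two_coloring_iff:
  "k_coloring G 2 f \<longleftrightarrow> (\<forall>v\<in>pverts G. 0 \<le> f v 1 \<and> f v 1 \<le> 1 \<and> f v 2 = 1 - f v 1)"
proof -
  have "{1..2} = {1, 2::nat}" by auto
  then show ?thesis by (auto simp: k_coloring_def)
qed

lemma shared_eq:
  assumes "k_coloring G 2 f" "v \<in> pverts G" "w \<in> pverts G"
  shows "shared f v w = 1 - \<bar>f v 1 - f w 1\<bar>"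
proof -
  have "{1..2} = {1, 2::nat}" by auto
  then show ?thesis using assms by (simp add: shared_def two_coloring_iff)
qed

lemma shared_nonneg:
  assumes "k_coloring G 2 f" "v \<in> pverts G" "w \<in> pverts G"
  shows "0 \<le> shared f v w"
  using assms by (auto simp: shared_def k_coloring_def intro!: sum_nonneg)

text \<open>Of three real numbers, one lies between the other two, so the three distances add up to twice
  the largest one, which is at most \<open>2\<close> in the unit interval.\<close>

lemma shared_triangle:
  assumes "k_coloring G 2 f" "u \<in> pverts G" "v \<in> pverts G" "w \<in> pverts G"
  shows "shared f u v + shared f u w + shared f v w \<ge> 1"
proof -
  have "0 \<le> f u 1" "f u 1 \<le> 1" "0 \<le> f v 1" "f v 1 \<le> 1" "0 \<le> f w 1" "f w 1 \<le> 1"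
    using assms by (auto simp: two_coloring_iff)
  then have "\<bar>f u 1 - f v 1\<bar> + \<bar>f u 1 - f w 1\<bar> + \<bar>f v 1 - f w 1\<bar> \<le> 2" by linarith
  then show ?thesis using assms by (simp add: shared_eq)
qed

lemma pverts_fan: "pverts (fan n) = {0..n}"
  by (auto simp: fan_def path_graph_def)

lemma nbhd_fan_hub: "nbhd (fan n) 0 = {1..n}"
  by (auto simp: nbhd_def fan_def path_graph_def)

lemma nbhd_fan_first: "n \<ge> 2 \<Longrightarrow> nbhd (fan n) 1 = {0, 2}"
  by (auto simp: nbhd_def fan_def path_graph_def)

lemma nbhd_fan_last: "n \<ge> 2 \<Longrightarrow> nbhd (fan n) n = {0, n - 1}"
  by (auto simp: nbhd_def fan_def path_graph_def)

lemma nbhd_fan_inner: "1 < i \<Longrightarrow> i < n \<Longrightarrow> nbhd (fan n) i = {0, i - 1, i + 1}"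
  by (auto simp: nbhd_def fan_def path_graph_def)

lemma vertex_defect_le_defect:
  assumes "pair_graph G" "v \<in> pverts G"
  shows "vertex_defect G k f v \<le> defect G k f"
proof -
  interpret pair_graph G by (rule assms)
  show ?thesis using assms(2) by (simp add: defect_def)
qed

lemma sum_triples:
  fixes g :: "nat \<Rightarrow> 'a::comm_monoid_add"
  shows "sum g {1..3 * m} = (\<Sum>k<m. g (3 * k + 1) + g (3 * k + 2) + g (3 * k + 3))"
proof (induction m)
  case (Suc m)
  have "{1..3 * Suc m} = {1..3 * m} \<union> {3 * m + 1, 3 * m + 2, 3 * m + 3}" by auto
  then have "sum g {1..3 * Suc m} = sum g {1..3 * m} + sum g {3 * m + 1, 3 * m + 2, 3 * m + 3}"
    by (simp only:) (rule sum.union_disjoint, auto)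
  then show ?case using Suc by (simp add: add.assoc)
qed simp

text \<open>The maximum defect is bounded by double counting: an edge from the hub to a middle vertex lies
  in two triangles, and both the hub and the middle vertex pay for it. Since a middle
  vertex pays at most the maximum defect \<open>D\<close>, its triple costs the hub at least \<open>2 - D\<close>, whence
  \<open>m (2 - D) \<le> D\<close>.\<close>

lemma defect_fan_ge:
  assumes f: "k_coloring (fan n) 2 f" and m: "m = n div 3"
  shows "2 * real m / (real m + 1) \<le> defect (fan n) 2 f"
proof -
  let ?D = "defect (fan n) 2 f" and ?d = "vertex_defect (fan n) 2 f"
  let ?s = "shared f"
  have le: "?d v \<le> ?D" if "v \<le> n" for v
    using vertex_defect_le_defect[OF pair_graph_fan] that by (simp add: pverts_fan)
  have n: "3 * m \<le> n" by (simp add: m)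
  have middle: "?s 0 (3*k+1) + ?s 0 (3*k+2) + ?s 0 (3*k+3) \<ge> 2 - ?D" if "k < m" for k
  proof -
    let ?u = "3*k+1" and ?v = "3*k+2" and ?w = "3*k+3"
    have "?w \<le> n" using that n by linarith
    then have P: "0 \<in> pverts (fan n)" "?u \<in> pverts (fan n)" "?v \<in> pverts (fan n)"
        "?w \<in> pverts (fan n)"
      by (auto simp: pverts_fan)
    have "nbhd (fan n) ?v = {0, ?u, ?w}"
      using nbhd_fan_inner[of ?v n] \<open>?w \<le> n\<close> by (simp add: numeral_3_eq_3)
    then have "?d ?v = ?s ?v 0 + ?s ?v ?u + ?s ?v ?w"
      by (simp add: vertex_defect_shared)
    moreover have "?d ?v \<le> ?D" using le \<open>?w \<le> n\<close> by simp
    moreover have "?s 0 ?u + ?s 0 ?v + ?s ?u ?v \<ge> 1" "?s 0 ?v + ?s 0 ?w + ?s ?v ?w \<ge> 1"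
      using shared_triangle[OF f] P by blast+
    moreover have "?s ?v 0 = ?s 0 ?v" "?s ?v ?u = ?s ?u ?v"
      by (simp_all add: shared_def min.commute)
    ultimately show ?thesis by linarith
  qed
  have "real m * (2 - ?D) \<le> (\<Sum>k<m. ?s 0 (3*k+1) + ?s 0 (3*k+2) + ?s 0 (3*k+3))"
    using sum_mono[of "{..<m}" "\<lambda>_. 2 - ?D", OF middle] by simp
  also have "\<dots> = sum (?s 0) {1..3 * m}" by (rule sum_triples[symmetric])
  also have "\<dots> \<le> sum (?s 0) {1..n}"
  proof (rule sum_mono2)
    show "0 \<le> ?s 0 i" if "i \<in> {1..n} - {1..3 * m}" for i
      using shared_nonneg[OF f] that by (auto simp: pverts_fan)
  qed (use n in auto)
  also have "\<dots> = ?d 0" by (simp add: vertex_defect_shared nbhd_fan_hub)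
  also have "\<dots> \<le> ?D" using le by simp
  finally show ?thesis by (simp add: field_simps)
qed

text \<open>The positions of the exceptional vertices have to be such that every inner path vertex is one
  of them or next to one of them, since an inner vertex using only color 1 between two such
  vertices has defect \<open>2\<close>. The multiples of 3 achieve this for every residue of \<open>n\<close> modulo 3.\<close>

definition fan_coloring :: "real \<Rightarrow> nat \<Rightarrow> nat \<Rightarrow> real" where
  "fan_coloring c v j =
     (let x = (if v = 0 then 0 else if 3 dvd v then c else 1) in if j = 1 then x else 1 - x)"

lemma sum_multiples_of_3:
  "(\<Sum>i=1..n. if 3 dvd i then r else 0) = real (n div 3) * (r::real)"
proof (induction n)
  case (Suc n)
  have "Suc n div 3 = (if 3 dvd Suc n then Suc (n div 3) else n div 3)"
    by (simp add: div_Suc dvd_eq_mod_eq_0)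
  then show ?case using Suc by (simp add: algebra_simps)
qed simp

lemma k_coloring_fan_coloring:
  assumes "0 \<le> c" "c \<le> 1"
  shows "k_coloring (fan n) 2 (fan_coloring c)"
  using assms by (simp add: two_coloring_iff fan_coloring_def)

lemma shared_fan_coloring:
  assumes "0 \<le> c" "c \<le> 1"
  shows "shared (fan_coloring c) v w = 1 - \<bar>fan_coloring c v 1 - fan_coloring c w 1\<bar>"
  using shared_eq[OF k_coloring_fan_coloring[OF assms, of "max v w"], of v w]
  by (simp add: pverts_fan)

lemma vertex_defect_hub_fan_coloring:
  assumes "0 \<le> c" "c \<le> 1"
  shows "vertex_defect (fan n) 2 (fan_coloring c) 0 = real (n div 3) * (1 - c)"
proof -
  have "vertex_defect (fan n) 2 (fan_coloring c) 0 = (\<Sum>i=1..n. if 3 dvd i then 1 - c else 0)"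
    unfolding vertex_defect_shared nbhd_fan_hub
    using assms by (intro sum.cong) (auto simp: shared_fan_coloring fan_coloring_def)
  then show ?thesis by (simp only: sum_multiples_of_3)
qed

lemma vertex_defect_path_fan_coloring:
  assumes n: "n \<ge> 3" and c: "0 \<le> c" "c \<le> 1" and i: "1 \<le> i" "i \<le> n"
  shows "vertex_defect (fan n) 2 (fan_coloring c) i \<le> 1 + c"
proof -
  note simps = vertex_defect_shared shared_fan_coloring[OF c] fan_coloring_def
  consider "i = 1" | "i = n" | "1 < i" "i < n" using i by linarith
  then show ?thesis
  proof cases
    case 1
    then show ?thesis using n c nbhd_fan_first[of n] by (simp add: simps)
  next
    case 2
    moreover have "\<not> 3 dvd n - 1" if "3 dvd n" using that n by presburger
    ultimately show ?thesis using n c nbhd_fan_last[of n] by (auto simp: simps)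
  next
    case 3
    then have "3 dvd i \<and> \<not> 3 dvd i - 1 \<and> \<not> 3 dvd i + 1 \<or>
        \<not> 3 dvd i \<and> 3 dvd i - 1 \<and> \<not> 3 dvd i + 1 \<or>
        \<not> 3 dvd i \<and> \<not> 3 dvd i - 1 \<and> 3 dvd i + 1"
      by presburger
    then consider "3 dvd i" "\<not> 3 dvd i - 1" "\<not> 3 dvd i + 1"
      | "\<not> 3 dvd i" "3 dvd i - 1" "\<not> 3 dvd i + 1"
      | "\<not> 3 dvd i" "\<not> 3 dvd i - 1" "3 dvd i + 1"
      by blast
    then show ?thesis using 3 c by cases (auto simp: nbhd_fan_inner simps)
  qed
qed

theorem proposition2:
  fixes n :: nat
  assumes "n \<ge> 3"
  shows "min_defect (fan n) 2 =
    2 * real_of_int \<lfloor>real n / 3\<rfloor> / (real_of_int \<lfloor>real n / 3\<rfloor> + 1)"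
proof -
  define m where "m = n div 3"
  define c where "c = (real m - 1) / (real m + 1)"
  have "m \<ge> 1" using assms by (simp add: m_def)
  then have c: "0 \<le> c" "c \<le> 1" by (auto simp: c_def)
  have value1: "1 + c = 2 * real m / (real m + 1)"
    by (simp add: c_def field_simps)
  have value2: "real m * (1 - c) = 2 * real m / (real m + 1)"
    by (simp add: c_def field_simps)
  have nonempty: "pverts (fan n) \<noteq> {}" by (simp add: pverts_fan)
  have finite: "finite (pverts (fan n))" by (simp add: pverts_fan)
  have "vertex_defect (fan n) 2 (fan_coloring c) v \<le> 2 * real m / (real m + 1)"
    if "v \<in> pverts (fan n)" for v
  proof (cases "v = 0")
    case True
    then show ?thesis
      using vertex_defect_hub_fan_coloring[OF c] value2 by (simp add: m_def)
  next
    case False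
    then show ?thesis
      using that vertex_defect_path_fan_coloring[OF assms c, of v] value1
      by (simp add: pverts_fan)
  qed
  then have "defect (fan n) 2 (fan_coloring c) \<le> 2 * real m / (real m + 1)"
    unfolding defect_def using finite nonempty by (intro Max.boundedI) auto
  moreover have "min_defect (fan n) 2 \<le> defect (fan n) 2 (fan_coloring c)"
    using min_defect_attained(2)[OF pair_graph_fan nonempty] k_coloring_fan_coloring[OF c] by simp
  moreover obtain f where "k_coloring (fan n) 2 f" "defect (fan n) 2 f = min_defect (fan n) 2"
    using min_defect_attained(1)[OF pair_graph_fan nonempty, of 2] by auto
  then have "2 * real m / (real m + 1) \<le> min_defect (fan n) 2"
    using defect_fan_ge[OF _ m_def] by metis
  ultimately have "min_defect (fan n) 2 = 2 * real m / (real m + 1)" by linarith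
  moreover have "\<lfloor>real n / 3\<rfloor> = int m"
    using floor_divide_of_nat_eq[of n 3, where ?'a = real] by (simp add: m_def)
  ultimately show ?thesis by simp
qed

end
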